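(* There exists an absolute constant $c>0$ such that the following holds. Let $K\subset\mathbb{R}^n$ be a (nonempty, closed) star-shaped set, assume that $x\in K$, and let the observations be $$y_i=\langle a_i,x\rangle+\varepsilon_i,\quad i=1,\dots,m,$$ where $a_1,\dots,a_m$ are independent standard normal vectors in $\mathbb{R}^n$ and $\varepsilon_i\sim N(0,\nu^2)$ are independent of each other and of the $a_i$. Let $$\delta_* := \inf_{t>0}\Big\{t+\frac{\nu}{\sqrt{m}}\Big[1+\sqrt{\log P_t}\Big]\Big\}.$$ Then any estimator $\widehat{x}$ which depends only on the observations $y_i$ and measurements $a_i$ satisfies $$\sup_{x\in K}\mathbb{E}\,\|\widehat{x}-x\|_2\ge c\,\min(\delta_*,\mathrm{diam}(K)).$$
   Context: A set $K$ is star-shaped if $\lambda K\subseteq K$ for all $0\le\lambda\le1$. $\nu>0$ is the noise level. An estimator is a measurable function $\widehat{x}$ of $(a_1,\dots,a_m,y_1,\dots,y_m)$ with values in $\mathbb{R}^n$. $B_2^n$ is the Euclidean unit ball of $\mathbb{R}^n$ and $\mathrm{diam}$ is the Euclidean diameter (possibly $+\infty$). Given a set $T\subset\mathbb{R}^n$ and $r>0$, a packing of $T$ with balls of radius $r$ is a set $\mathcal{X}\subset T$ with $\|v-w\|_2\ge r$ for each pair of distinct $v,w\in\mathcal{X}$; the packing number is the cardinality of the largest such packing. The local packing number $P_t$ of $K$ is the packing number of $K\cap tB_2^n$ with balls of radius $t/10$. *)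

theory Defs
  imports "HOL-Probability.Probability"
begin

text \<open>
  The dimension \<open>n\<close> has to be quantified after the absolute constant, so it cannot be a type.
  \<open>\<real>\<^sup>n\<close> is the set \<open>{..<n} \<rightarrow>\<^sub>E UNIV\<close> of functions \<open>nat \<Rightarrow> real\<close> that are \<open>undefined\<close> outside
  \<open>{..<n}\<close>; this is the carrier both of \<open>PiM {..<n} (\<lambda>_. borel)\<close> and of the library topology
  \<open>powertop_real {..<n}\<close>.
\<close>

definition rn_norm :: "nat \<Rightarrow> (nat \<Rightarrow> real) \<Rightarrow> real" where
  "rn_norm n v = L2_set v {..<n}"

definition rn_dist :: "nat \<Rightarrow> (nat \<Rightarrow> real) \<Rightarrow> (nat \<Rightarrow> real) \<Rightarrow> real" where
  "rn_dist n v w = rn_norm n (\<lambda>j. v j - w j)"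

definition rn_inner :: "nat \<Rightarrow> (nat \<Rightarrow> real) \<Rightarrow> (nat \<Rightarrow> real) \<Rightarrow> real" where
  "rn_inner n v w = (\<Sum>j<n. v j * w j)"

definition rn_borel :: "nat \<Rightarrow> (nat \<Rightarrow> real) measure" where
  "rn_borel n = PiM {..<n} (\<lambda>_. borel)"

definition rn_closed :: "nat \<Rightarrow> (nat \<Rightarrow> real) set \<Rightarrow> bool" where
  "rn_closed n K \<longleftrightarrow> closedin (powertop_real {..<n}) K"

lemma rn_closed_subset: "rn_closed n K \<Longrightarrow> K \<subseteq> {..<n} \<rightarrow>\<^sub>E UNIV"
  unfolding rn_closed_def using closedin_subset by fastforce

definition rn_diam :: "nat \<Rightarrow> (nat \<Rightarrow> real) set \<Rightarrow> ennreal" where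
  "rn_diam n K = (SUP v\<in>K. SUP w\<in>K. ennreal (rn_dist n v w))"

definition star_shaped :: "nat \<Rightarrow> (nat \<Rightarrow> real) set \<Rightarrow> bool" where
  "star_shaped n K \<longleftrightarrow> (\<forall>l\<in>{0..1}. (\<lambda>v. \<lambda>j\<in>{..<n}. l * v j) ` K \<subseteq> K)"

definition is_packing :: "nat \<Rightarrow> (nat \<Rightarrow> real) set \<Rightarrow> real \<Rightarrow> (nat \<Rightarrow> real) set \<Rightarrow> bool" where
  "is_packing n T r X \<longleftrightarrow> X \<subseteq> T \<and> (\<forall>v\<in>X. \<forall>w\<in>X. v \<noteq> w \<longrightarrow> rn_dist n v w \<ge> r)"

text \<open>
  The maximum is meaningful when the cardinalities of packings are bounded, in particular for
  every bounded \<open>T\<close>; see \<open>local_packings_finite\<close> below.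
\<close>

definition packing_number :: "nat \<Rightarrow> (nat \<Rightarrow> real) set \<Rightarrow> real \<Rightarrow> nat" where
  "packing_number n T r = Max (card ` {X. is_packing n T r X})"

definition local_packing_number :: "nat \<Rightarrow> (nat \<Rightarrow> real) set \<Rightarrow> real \<Rightarrow> nat" where
  "local_packing_number n K t = packing_number n (K \<inter> {v. rn_norm n v \<le> t}) (t / 10)"

lemma local_packings_finite:
  assumes K: "K \<subseteq> {..<n} \<rightarrow>\<^sub>E UNIV" and t: "t > 0"
  defines "T \<equiv> K \<inter> {v. rn_norm n v \<le> t}"
  shows "\<And>X. is_packing n T (t / 10) X \<Longrightarrow> finite X"
    and "finite (card ` {X. is_packing n T (t / 10) X})"
proof -
  define k where "k = 10 * (real n + 1) / t"
  have kpos: "k > 0" using t by (simp add: k_def)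
  define g where "g v = (\<lambda>j\<in>{..<n}. \<lfloor>v j * k\<rfloor>)" for v :: "nat \<Rightarrow> real"
  define G where "G = {..<n} \<rightarrow>\<^sub>E {\<lfloor>- t * k\<rfloor>..\<lfloor>t * k\<rfloor>}"
  have finG: "finite G" unfolding G_def by (intro finite_PiE) auto
  have gG: "g v \<in> G" if "v \<in> T" for v
  proof -
    have "\<bar>v j\<bar> \<le> t" if "j < n" for j
    proof -
      have "(v j)\<^sup>2 \<le> (\<Sum>i<n. (v i)\<^sup>2)"
        using that by (intro member_le_sum) auto
      then have "\<bar>v j\<bar> \<le> rn_norm n v"
        unfolding rn_norm_def L2_set_def using real_le_rsqrt by fastforce
      then show ?thesis using \<open>v \<in> T\<close> by (simp add: T_def)
    qed
    then have "- t * k \<le> v j * k \<and> v j * k \<le> t * k" if "j < n" for j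
      using that kpos by (intro conjI mult_right_mono) (fastforce simp: abs_le_iff)+
    then show ?thesis
      unfolding G_def g_def by (auto intro!: floor_mono)
  qed
  have close: "rn_dist n v w < t / 10" if eq: "g v = g w" for v w
  proof -
    have "\<bar>v j - w j\<bar> \<le> 1 / k" if "j < n" for j
    proof -
      have "\<lfloor>v j * k\<rfloor> = \<lfloor>w j * k\<rfloor>" using fun_cong[OF eq, of j] that by (simp add: g_def)
      then have "\<bar>v j * k - w j * k\<bar> \<le> 1" by linarith
      then have "\<bar>v j - w j\<bar> * k \<le> 1"
        using kpos by (simp add: abs_mult left_diff_distrib[symmetric])
      then show ?thesis using kpos by (simp add: field_simps)
    qed
    then have "(\<Sum>j<n. \<bar>v j - w j\<bar>) \<le> (\<Sum>j<n. 1 / k)" by (intro sum_mono) auto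
    moreover have "rn_dist n v w \<le> (\<Sum>j<n. \<bar>v j - w j\<bar>)"
      unfolding rn_dist_def rn_norm_def by (rule L2_set_le_sum_abs)
    moreover have "(\<Sum>j<n. 1 / k) < t / 10"
      using t by (simp add: k_def field_simps)
    ultimately show ?thesis by linarith
  qed
  have inj: "inj_on g X" "g ` X \<subseteq> G" if "is_packing n T (t / 10) X" for X
    using that gG close unfolding is_packing_def inj_on_def by (force simp: not_less)+
  show "finite X" if "is_packing n T (t / 10) X" for X
    using inj[OF that] finG by (meson finite_imageD finite_subset)
  have "card X \<le> card G" if "is_packing n T (t / 10) X" for X
    using inj[OF that] finG by (meson card_inj_on_le)
  then have "card ` {X. is_packing n T (t / 10) X} \<subseteq> {..card G}" by auto
  then show "finite (card ` {X. is_packing n T (t / 10) X})"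
    using finite_subset by blast
qed

definition delta_star :: "nat \<Rightarrow> nat \<Rightarrow> real \<Rightarrow> (nat \<Rightarrow> real) set \<Rightarrow> real" where
  "delta_star n m \<nu> K =
     (INF t\<in>{0<..}. t + \<nu> / sqrt (real m) * (1 + sqrt (ln (real (local_packing_number n K t)))))"

text \<open>
  The joint law of \<open>((a\<^sub>1, \<dots>, a\<^sub>m), (\<epsilon>\<^sub>1, \<dots>, \<epsilon>\<^sub>m))\<close>; indices run over \<open>{..<m}\<close>.
  The second parameter of \<open>normal_density\<close> is the standard deviation.
\<close>

definition std_normal_vector :: "nat \<Rightarrow> (nat \<Rightarrow> real) measure" where
  "std_normal_vector n = PiM {..<n} (\<lambda>_. density lborel (normal_density 0 1))"

definition model_law ::
  "nat \<Rightarrow> nat \<Rightarrow> real \<Rightarrow> ((nat \<Rightarrow> nat \<Rightarrow> real) \<times> (nat \<Rightarrow> real)) measure" where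
  "model_law n m \<nu> =
     PiM {..<m} (\<lambda>_. std_normal_vector n)
       \<Otimes>\<^sub>M PiM {..<m} (\<lambda>_. density lborel (normal_density 0 \<nu>))"

definition observations ::
  "nat \<Rightarrow> nat \<Rightarrow> (nat \<Rightarrow> real) \<Rightarrow> (nat \<Rightarrow> nat \<Rightarrow> real) \<Rightarrow> (nat \<Rightarrow> real) \<Rightarrow> nat \<Rightarrow> real" where
  "observations n m x a \<epsilon> = (\<lambda>i\<in>{..<m}. rn_inner n (a i) x + \<epsilon> i)"

definition estimators ::
  "nat \<Rightarrow> nat \<Rightarrow> ((nat \<Rightarrow> nat \<Rightarrow> real) \<times> (nat \<Rightarrow> real) \<Rightarrow> nat \<Rightarrow> real) set" where
  "estimators n m = measurable (PiM {..<m} (\<lambda>_. rn_borel n) \<Otimes>\<^sub>M rn_borel m) (rn_borel n)"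

text \<open>The expected error is \<open>ennreal\<close>-valued, since it may be infinite.\<close>

definition risk ::
  "nat \<Rightarrow> nat \<Rightarrow> real \<Rightarrow> ((nat \<Rightarrow> nat \<Rightarrow> real) \<times> (nat \<Rightarrow> real) \<Rightarrow> nat \<Rightarrow> real) \<Rightarrow>
    (nat \<Rightarrow> real) \<Rightarrow> ennreal" where
  "risk n m \<nu> xhat x =
     (\<integral>\<^sup>+ (a, \<epsilon>). ennreal (rn_dist n (xhat (a, observations n m x a \<epsilon>)) x) \<partial>model_law n m \<nu>)"

end

theory Submission
  imports Defs
begin

text \<open>
  The proof compares every signal with the signal \<open>0\<close>. Let \<open>u = \<nu> / \<surd>m\<close>, and let \<open>Q\<close> be the law of
  \<open>(a, y)\<close> when \<open>x = 0\<close>. For another signal \<open>x\<close> the law of \<open>(a, y)\<close> has the explicit density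
  \<open>L\<^sub>x = exp (\<Sum>\<^sub>i (y\<^sub>i g\<^sub>i - g\<^sub>i\<^sup>2 / 2) / \<nu>\<^sup>2)\<close> relative to \<open>Q\<close>, where \<open>g\<^sub>i = \<langle>a\<^sub>i, x\<rangle>\<close>
  (\<open>change_of_measure\<close>). Under the signal \<open>x\<close>, \<open>ln L\<^sub>x\<close> is with
  high probability at most of the order of \<open>\<parallel>x\<parallel>\<^sup>2 / u\<^sup>2 + \<parallel>x\<parallel> / u\<close>, by a second
  moment computation (\<open>likelihood_ratio_tail\<close>).

  Suppose that \<open>N \<ge> 2\<close> signals have mutual distances at least \<open>r\<close>. The estimate can be nearer
  than \<open>r / 2\<close> to only one of them, so the \<open>N\<close> events of success are disjoint and their
  \<open>Q\<close>-probabilities have average at most \<open>1 / N\<close>. If each \<open>L\<^sub>x\<close> stays below \<open>\<surd>N\<close> with high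
  probability under \<open>x\<close>, then success under the true signal is bounded away from certainty, and the risk is at
  least a multiple of \<open>r\<close> (\<open>multiple_hypotheses_lower_bound\<close>, \<open>packing_risk_lower_bound\<close>). By the
  size of \<open>ln L\<^sub>x\<close> this works as soon as the norms are at most a small multiple of
  \<open>u \<surd>(ln N)\<close>.

  There are two cases. If \<open>\<delta>\<^sub>* \<ge> 4 u\<close>, apply this to a maximal local packing at radius
  \<open>t = \<delta>\<^sub>* / 16\<close>: by the definition of \<open>\<delta>\<^sub>*\<close> as an infimum, \<open>\<delta>\<^sub>* \<le> t + u (1 + \<surd>(ln P\<^sub>t))\<close>, so
  \<open>u \<surd>(ln P\<^sub>t)\<close> is at least \<open>\<delta>\<^sub>* / 2 = 8 t\<close>, and the packing is rich enough for its radius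
  (\<open>risk_lower_bound_large_delta\<close>). If \<open>\<delta>\<^sub>* \<le> 4 u\<close>, two points are enough: a nonempty star-shaped set
  contains the origin and, for each of its points \<open>v\<close>, a point of norm \<open>min \<parallel>v\<parallel> (u / 18)\<close>
  (\<open>risk_lower_bound_small_delta\<close>).
\<close>

section \<open>Gaussian product measures\<close>

abbreviation gauss :: "real \<Rightarrow> real measure" where
  "gauss \<sigma> \<equiv> density lborel (normal_density 0 \<sigma>)"

lemma prob_space_gauss: "\<sigma> > 0 \<Longrightarrow> prob_space (gauss \<sigma>)"
  by (rule prob_space_normal_density)

text \<open>
  The Cameron--Martin formula on the line: the density of \<open>N(b, \<sigma>\<^sup>2)\<close> relative to
  \<open>N(0, \<sigma>\<^sup>2)\<close> is the quotient of the two Lebesgue densities, in which the quadratic terms cancel.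
\<close>

lemma distr_gauss_shift:
  fixes \<sigma> b :: real
  assumes \<sigma>: "\<sigma> > 0"
  shows "distr (gauss \<sigma>) borel (\<lambda>e. b + e) =
    density (gauss \<sigma>) (\<lambda>e. ennreal (exp ((e * b - b\<^sup>2 / 2) / \<sigma>\<^sup>2)))" (is "?D = ?E")
proof (rule measure_eqI)
  fix A assume "A \<in> sets ?D"
  then have A[measurable]: "A \<in> sets borel" by simp
  have dens: "normal_density 0 \<sigma> y * exp ((y * b - b\<^sup>2 / 2) / \<sigma>\<^sup>2) = normal_density 0 \<sigma> (y - b)" for y
    using \<sigma> by (simp add: normal_density_def exp_add[symmetric] field_simps power2_eq_square)
  have "emeasure ?D A = (\<integral>\<^sup>+ e. indicator A (b + e) \<partial>gauss \<sigma>)"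
    by (simp add: nn_integral_indicator[symmetric] nn_integral_distr del: nn_integral_indicator)
  also have "\<dots> = (\<integral>\<^sup>+ e. ennreal (normal_density 0 \<sigma> e) * indicator A (b + e) \<partial>lborel)"
    by (subst nn_integral_density) auto
  also have "\<dots> = (\<integral>\<^sup>+ y. ennreal (normal_density 0 \<sigma> (y - b)) * indicator A y \<partial>lborel)"
    by (subst (2) nn_integral_real_affine[where c = 1 and t = b]) auto
  also have "\<dots> = (\<integral>\<^sup>+ y. ennreal (normal_density 0 \<sigma> y) *
      (ennreal (exp ((y * b - b\<^sup>2 / 2) / \<sigma>\<^sup>2)) * indicator A y) \<partial>lborel)"
    by (simp add: dens[symmetric] ennreal_mult mult.assoc)
  also have "\<dots> = emeasure ?E A"
    by (simp add: emeasure_density nn_integral_density)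
  finally show "emeasure ?D A = emeasure ?E A" .
qed simp

text \<open>
  Both sides are product measures: the shift acts on each coordinate separately, and the density
  on the right is a product of functions of one coordinate. Hence it suffices to compare them on
  boxes, where the one-dimensional formula applies to each factor.
\<close>

lemma distr_PiM_gauss_shift:
  fixes \<sigma> :: real and b :: "'i \<Rightarrow> real"
  assumes \<sigma>: "\<sigma> > 0" and I: "finite I"
  shows "distr (PiM I (\<lambda>_. gauss \<sigma>)) (PiM I (\<lambda>_. borel)) (\<lambda>e. \<lambda>i\<in>I. b i + e i) =
    density (PiM I (\<lambda>_. gauss \<sigma>))
      (\<lambda>e. ennreal (exp ((\<Sum>i\<in>I. e i * b i - (b i)\<^sup>2 / 2) / \<sigma>\<^sup>2)))" (is "?D = ?E")
proof -
  interpret G: prob_space "gauss \<sigma>" by (rule prob_space_gauss[OF \<sigma>])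
  interpret GP: product_sigma_finite "\<lambda>_::'i. gauss \<sigma>" by standard
  let ?N = "\<lambda>i. distr (gauss \<sigma>) borel (\<lambda>e. b i + e)"
  have N: "prob_space (?N i)" for i by (intro G.prob_space_distr) auto
  interpret N: product_prob_space ?N using N by (rule product_prob_spaceI)
  have setsN: "sets (PiM I ?N) = sets (PiM I (\<lambda>_. borel))"
    by (intro sets_PiM_cong) auto
  have "?D = PiM I ?N"
  proof (rule N.PiM_eqI[OF I])
    fix B assume "\<And>i. i \<in> I \<Longrightarrow> B i \<in> sets (?N i)"
    then have B[measurable]: "\<And>i. i \<in> I \<Longrightarrow> B i \<in> sets borel" by simp
    have [measurable]: "Pi\<^sub>E I B \<in> sets (PiM I (\<lambda>_. borel))" using I B by (intro sets_PiM_I_finite) auto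
    have "emeasure ?D (Pi\<^sub>E I B) = emeasure (PiM I (\<lambda>_. gauss \<sigma>)) (Pi\<^sub>E I (\<lambda>i. (\<lambda>e. b i + e) -` B i))"
      by (subst emeasure_distr) (auto intro!: arg_cong2[where f = emeasure] simp: space_PiM PiE_iff)
    also have "\<dots> = (\<Prod>i\<in>I. emeasure (gauss \<sigma>) ((\<lambda>e. b i + e) -` B i))"
      by (rule GP.emeasure_PiM[OF I])
        (use B in \<open>auto intro!: measurable_sets_borel[of "\<lambda>e. b i + e" borel for i]\<close>)
    also have "\<dots> = (\<Prod>i\<in>I. emeasure (?N i) (B i))"
      by (intro prod.cong refl) (subst emeasure_distr, auto)
    finally show "emeasure ?D (Pi\<^sub>E I B) = (\<Prod>i\<in>I. emeasure (?N i) (B i))" .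
  qed (simp add: setsN)
  moreover have "?E = PiM I ?N"
  proof (rule N.PiM_eqI[OF I])
    fix B assume "\<And>i. i \<in> I \<Longrightarrow> B i \<in> sets (?N i)"
    then have B[measurable]: "\<And>i. i \<in> I \<Longrightarrow> B i \<in> sets borel" by simp
    let ?f = "\<lambda>i e. ennreal (exp ((e * b i - (b i)\<^sup>2 / 2) / \<sigma>\<^sup>2))"
    have [measurable]: "Pi\<^sub>E I B \<in> sets (PiM I (\<lambda>_. gauss \<sigma>))" using I B by (intro sets_PiM_I_finite) auto
    have eq: "ennreal (exp ((\<Sum>i\<in>I. e i * b i - (b i)\<^sup>2 / 2) / \<sigma>\<^sup>2)) * indicator (Pi\<^sub>E I B) e
        = (\<Prod>i\<in>I. ?f i (e i) * indicator (B i) (e i))" if "e \<in> space (PiM I (\<lambda>_. gauss \<sigma>))" for e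
    proof -
      have "indicator (Pi\<^sub>E I B) e = (\<Prod>i\<in>I. indicator (B i) (e i) :: ennreal)"
        using that I by (auto simp: space_PiM PiE_iff indicator_def)
      then show ?thesis
        by (simp add: prod.distrib sum_divide_distrib exp_sum[OF I] prod_ennreal)
    qed
    have "emeasure ?E (Pi\<^sub>E I B) =
        (\<integral>\<^sup>+ e. (\<Prod>i\<in>I. ?f i (e i) * indicator (B i) (e i)) \<partial>PiM I (\<lambda>_. gauss \<sigma>))"
      by (subst emeasure_density) (auto intro!: nn_integral_cong eq)
    also have "\<dots> = (\<Prod>i\<in>I. \<integral>\<^sup>+ e. ?f i e * indicator (B i) e \<partial>gauss \<sigma>)"
      by (rule GP.product_nn_integral_prod[OF I]) (use B in auto)
    also have "\<dots> = (\<Prod>i\<in>I. emeasure (?N i) (B i))"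
      unfolding distr_gauss_shift[OF \<sigma>] by (intro prod.cong refl) (subst emeasure_density, auto)
    finally show "emeasure ?E (Pi\<^sub>E I B) = (\<Prod>i\<in>I. emeasure (?N i) (B i))" .
  qed (use setsN in \<open>auto intro!: sets_PiM_cong\<close>)
  ultimately show ?thesis by simp
qed

lemma nn_integral_gauss_affine_square:
  assumes \<sigma>: "\<sigma> > 0"
  shows "(\<integral>\<^sup>+ y. ennreal ((b + c * y)\<^sup>2) \<partial>gauss \<sigma>) = ennreal (b\<^sup>2 + c\<^sup>2 * \<sigma>\<^sup>2)"
proof -
  have "has_bochner_integral lborel (\<lambda>y. b\<^sup>2 * (normal_density 0 \<sigma> y * (y - 0) ^ (2 * 0))
      + 2 * b * c * (normal_density 0 \<sigma> y * (y - 0) ^ (2 * 0 + 1))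
      + c\<^sup>2 * (normal_density 0 \<sigma> y * (y - 0) ^ (2 * 1)))
      (b\<^sup>2 * (fact (2 * 0) / ((2 / \<sigma>\<^sup>2) ^ 0 * fact 0)) + 2 * b * c * 0
       + c\<^sup>2 * (fact (2 * 1) / ((2 / \<sigma>\<^sup>2) ^ 1 * fact 1)))"
    by (intro has_bochner_integral_add has_bochner_integral_mult_right
        normal_moment_even normal_moment_odd \<sigma>)
  moreover have "(\<lambda>y. b\<^sup>2 * (normal_density 0 \<sigma> y * (y - 0) ^ (2 * 0))
      + 2 * b * c * (normal_density 0 \<sigma> y * (y - 0) ^ (2 * 0 + 1))
      + c\<^sup>2 * (normal_density 0 \<sigma> y * (y - 0) ^ (2 * 1)))
      = (\<lambda>y. normal_density 0 \<sigma> y * (b + c * y)\<^sup>2)"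
    by (simp add: fun_eq_iff power2_eq_square algebra_simps)
  ultimately have "has_bochner_integral lborel (\<lambda>y. normal_density 0 \<sigma> y * (b + c * y)\<^sup>2)
      (b\<^sup>2 + c\<^sup>2 * \<sigma>\<^sup>2)"
    by (simp add: fact_numeral)
  then have "(\<integral>\<^sup>+ y. ennreal (normal_density 0 \<sigma> y * (b + c * y)\<^sup>2) \<partial>lborel) = ennreal (b\<^sup>2 + c\<^sup>2 * \<sigma>\<^sup>2)"
    by (subst nn_integral_eq_integral) (auto simp: has_bochner_integral_iff)
  then show ?thesis
    by (subst nn_integral_density) (auto simp: ennreal_mult)
qed

text \<open>
  The variance of a linear combination of independent centred Gaussians. It serves twice: with
  the random coefficients \<open>\<langle>a\<^sub>i, x\<rangle>\<close> for the noise, and with the coefficients \<open>x\<^sub>j\<close> for the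
  entries of one measurement vector. The coordinates are integrated out one at a time, and the cross term
  vanishes at each step because the new coordinate is centred.
\<close>

lemma nn_integral_PiM_gauss_linear_square:
  assumes \<sigma>: "\<sigma> > 0" and I: "finite I"
  shows "(\<integral>\<^sup>+ e. ennreal ((\<Sum>i\<in>I. c i * e i)\<^sup>2) \<partial>PiM I (\<lambda>_. gauss \<sigma>)) =
    ennreal (\<sigma>\<^sup>2 * (\<Sum>i\<in>I. (c i)\<^sup>2))"
  using I
proof induction
  case empty
  show ?case by (simp add: nn_integral_empty PiM_empty)
next
  case (insert k I)
  interpret G: prob_space "gauss \<sigma>" by (rule prob_space_gauss[OF \<sigma>])
  interpret GP: product_prob_space "\<lambda>_. gauss \<sigma>" I by standard
  have "(\<integral>\<^sup>+ e. ennreal ((\<Sum>i\<in>insert k I. c i * e i)\<^sup>2) \<partial>PiM (insert k I) (\<lambda>_. gauss \<sigma>))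
      = (\<integral>\<^sup>+ e. \<integral>\<^sup>+ y. ennreal ((\<Sum>i\<in>insert k I. c i * (e(k := y)) i)\<^sup>2) \<partial>gauss \<sigma> \<partial>PiM I (\<lambda>_. gauss \<sigma>))"
    using insert.hyps by (intro GP.product_nn_integral_insert) auto
  also have "\<dots> = (\<integral>\<^sup>+ e. \<integral>\<^sup>+ y. ennreal (((\<Sum>i\<in>I. c i * e i) + c k * y)\<^sup>2) \<partial>gauss \<sigma> \<partial>PiM I (\<lambda>_. gauss \<sigma>))"
  proof -
    have "(\<Sum>i\<in>insert k I. c i * (e(k := y)) i) = (\<Sum>i\<in>I. c i * e i) + c k * y" for e y
    proof -
      have "(\<Sum>i\<in>I. c i * (e(k := y)) i) = (\<Sum>i\<in>I. c i * e i)"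
        using insert.hyps by (intro sum.cong) auto
      then show ?thesis using insert.hyps by simp
    qed
    then show ?thesis by simp
  qed
  also have "\<dots> = (\<integral>\<^sup>+ e. ennreal ((\<Sum>i\<in>I. c i * e i)\<^sup>2) + ennreal ((c k)\<^sup>2 * \<sigma>\<^sup>2) \<partial>PiM I (\<lambda>_. gauss \<sigma>))"
    by (simp add: nn_integral_gauss_affine_square[OF \<sigma>])
  also have "\<dots> = ennreal (\<sigma>\<^sup>2 * (\<Sum>i\<in>I. (c i)\<^sup>2)) + ennreal ((c k)\<^sup>2 * \<sigma>\<^sup>2)"
    using insert.IH by (subst nn_integral_add) (auto simp: GP.P.emeasure_space_1)
  also have "\<dots> = ennreal (\<sigma>\<^sup>2 * (\<Sum>i\<in>insert k I. (c i)\<^sup>2))"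
    using insert.hyps by (subst ennreal_plus[symmetric]) (auto intro!: sum_nonneg mult_nonneg_nonneg simp: algebra_simps)
  finally show ?case .
qed

section \<open>Testing many hypotheses\<close>

text \<open>
  This takes the place of Fano's inequality. The \<open>x\<close>-th hypothesis has density \<open>L x\<close> relative
  to \<open>M\<close>. By separation, the events that the loss for \<open>x\<close> is below \<open>\<rho>\<close> are disjoint, so their
  \<open>M\<close>-probabilities add up to at most one. Where \<open>L x \<le> \<Lambda>\<close>, the probability of the \<open>x\<close>-th
  event under its own hypothesis is at most \<open>\<Lambda>\<close> times its \<open>M\<close>-probability; the part where
  \<open>L x > \<Lambda>\<close> contributes at most \<open>p\<close>. So on average over \<open>x\<close> the loss is below \<open>\<rho>\<close> with
  probability at most \<open>p + \<Lambda> / card X\<close>, and on the complement it costs at least \<open>\<rho>\<close>.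
\<close>

lemma (in prob_space) multiple_hypotheses_lower_bound:
  fixes L loss :: "'x \<Rightarrow> 'a \<Rightarrow> ennreal" and \<rho> R \<Lambda> p :: real
  assumes X: "finite X" "X \<noteq> {}"
    and L[measurable]: "\<And>x. x \<in> X \<Longrightarrow> L x \<in> borel_measurable M"
    and L1: "\<And>x. x \<in> X \<Longrightarrow> (\<integral>\<^sup>+ \<omega>. L x \<omega> \<partial>M) = 1"
    and loss[measurable]: "\<And>x. x \<in> X \<Longrightarrow> loss x \<in> borel_measurable M"
    and sep: "\<And>x y \<omega>. x \<in> X \<Longrightarrow> y \<in> X \<Longrightarrow> x \<noteq> y \<Longrightarrow> \<omega> \<in> space M \<Longrightarrow>
        loss x \<omega> < ennreal \<rho> \<Longrightarrow> ennreal \<rho> \<le> loss y \<omega>"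
    and tail: "\<And>x. x \<in> X \<Longrightarrow>
        (\<integral>\<^sup>+ \<omega>. L x \<omega> * indicator {\<omega>. L x \<omega> > ennreal \<Lambda>} \<omega> \<partial>M) \<le> ennreal p"
    and nonneg: "\<rho> \<ge> 0" "\<Lambda> \<ge> 0" "p \<ge> 0"
    and risk: "\<And>x. x \<in> X \<Longrightarrow> (\<integral>\<^sup>+ \<omega>. L x \<omega> * loss x \<omega> \<partial>M) \<le> ennreal R"
    and "R \<ge> 0"
  shows "\<rho> * (1 - p - \<Lambda> / card X) \<le> R"
proof -
  define A where "A x = {\<omega> \<in> space M. loss x \<omega> < ennreal \<rho>}" for x
  have A[measurable]: "A x \<in> sets M" if "x \<in> X" for x
    using loss[OF that] unfolding A_def by measurable
  let ?N = "real (card X)"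
  have N: "?N > 0" using X by (simp add: card_gt_0_iff)
  have disj: "disjoint_family_on A X"
    using sep by (fastforce simp: disjoint_family_on_def A_def)
  have "(\<Sum>x\<in>X. \<integral>\<^sup>+ \<omega>. L x \<omega> * indicator (A x) \<omega> \<partial>M)
      \<le> (\<Sum>x\<in>X. ennreal p + ennreal \<Lambda> * emeasure M (A x))"
  proof (rule sum_mono)
    fix x assume x: "x \<in> X"
    note [measurable] = L[OF x] A[OF x]
    have "(\<integral>\<^sup>+ \<omega>. L x \<omega> * indicator (A x) \<omega> \<partial>M) \<le>
        (\<integral>\<^sup>+ \<omega>. L x \<omega> * indicator {\<omega>. L x \<omega> > ennreal \<Lambda>} \<omega> + ennreal \<Lambda> * indicator (A x) \<omega> \<partial>M)"
      by (intro nn_integral_mono) (auto simp: indicator_def not_less)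
    also have "\<dots> = (\<integral>\<^sup>+ \<omega>. L x \<omega> * indicator {\<omega>. L x \<omega> > ennreal \<Lambda>} \<omega> \<partial>M) + ennreal \<Lambda> * emeasure M (A x)"
    proof (subst nn_integral_add)
      have "(\<lambda>\<omega>. L x \<omega> * indicator {\<omega>. L x \<omega> > ennreal \<Lambda>} \<omega>) = (\<lambda>\<omega>. if L x \<omega> > ennreal \<Lambda> then L x \<omega> else 0)"
        by (auto simp: indicator_def)
      then show "(\<lambda>\<omega>. L x \<omega> * indicator {\<omega>. L x \<omega> > ennreal \<Lambda>} \<omega>) \<in> borel_measurable M"
        by simp
    qed (auto simp: nn_integral_cmult_indicator)
    also have "\<dots> \<le> ennreal p + ennreal \<Lambda> * emeasure M (A x)"
      by (intro add_mono tail x order_refl)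
    finally show "(\<integral>\<^sup>+ \<omega>. L x \<omega> * indicator (A x) \<omega> \<partial>M) \<le> ennreal p + ennreal \<Lambda> * emeasure M (A x)" .
  qed
  also have "\<dots> = ennreal (?N * p) + ennreal \<Lambda> * emeasure M (\<Union>x\<in>X. A x)"
    using X nonneg disj A by (subst sum_emeasure[symmetric])
      (auto simp: sum.distrib sum_distrib_left ennreal_mult ennreal_of_nat_eq_real_of_nat)
  also have "\<dots> \<le> ennreal (?N * p) + ennreal \<Lambda> * 1"
    by (intro add_mono mult_left_mono) (auto simp: emeasure_le_1)
  finally have correct: "(\<Sum>x\<in>X. \<integral>\<^sup>+ \<omega>. L x \<omega> * indicator (A x) \<omega> \<partial>M) \<le> ennreal (?N * p + \<Lambda>)"
    using nonneg by simp
  have "ennreal (?N * \<rho>) = (\<Sum>x\<in>X. ennreal \<rho>)"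
    using nonneg by (simp add: ennreal_mult ennreal_of_nat_eq_real_of_nat)
  also have "\<dots> \<le> (\<Sum>x\<in>X. ennreal R + ennreal \<rho> * (\<integral>\<^sup>+ \<omega>. L x \<omega> * indicator (A x) \<omega> \<partial>M))"
  proof (rule sum_mono)
    fix x assume x: "x \<in> X"
    note [measurable] = L[OF x] A[OF x] loss[OF x]
    have "ennreal \<rho> = (\<integral>\<^sup>+ \<omega>. ennreal \<rho> * L x \<omega> \<partial>M)"
      by (simp add: nn_integral_cmult L1[OF x])
    also have "\<dots> \<le> (\<integral>\<^sup>+ \<omega>. L x \<omega> * loss x \<omega> + ennreal \<rho> * (L x \<omega> * indicator (A x) \<omega>) \<partial>M)"
    proof (rule nn_integral_mono)
      fix \<omega> assume "\<omega> \<in> space M"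
      then show "ennreal \<rho> * L x \<omega> \<le> L x \<omega> * loss x \<omega> + ennreal \<rho> * (L x \<omega> * indicator (A x) \<omega>)"
        by (auto simp: A_def indicator_def not_less mult.commute[of "ennreal \<rho>"] intro: mult_left_mono add_increasing)
    qed
    also have "\<dots> \<le> ennreal R + ennreal \<rho> * (\<integral>\<^sup>+ \<omega>. L x \<omega> * indicator (A x) \<omega> \<partial>M)"
      using risk[OF x] by (simp add: nn_integral_add nn_integral_cmult add_mono)
    finally show "ennreal \<rho> \<le> \<dots>" .
  qed
  also have "\<dots> = ennreal (?N * R) + ennreal \<rho> * (\<Sum>x\<in>X. \<integral>\<^sup>+ \<omega>. L x \<omega> * indicator (A x) \<omega> \<partial>M)"
    using \<open>R \<ge> 0\<close> by (simp add: sum.distrib sum_distrib_left ennreal_mult ennreal_of_nat_eq_real_of_nat)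
  also have "\<dots> \<le> ennreal (?N * R) + ennreal \<rho> * ennreal (?N * p + \<Lambda>)"
    by (intro add_mono mult_left_mono correct) auto
  also have "\<dots> = ennreal (?N * R + \<rho> * (?N * p + \<Lambda>))"
    using nonneg \<open>R \<ge> 0\<close> by (simp add: ennreal_mult)
  finally have "?N * \<rho> \<le> ?N * R + \<rho> * (?N * p + \<Lambda>)"
    using nonneg \<open>R \<ge> 0\<close> by (subst (asm) ennreal_le_iff) auto
  then show ?thesis using N by (simp add: field_simps)
qed

section \<open>The likelihood ratio of the linear model\<close>

text \<open>
  The density of the law of \<open>(a, y)\<close> for the signal \<open>x\<close> relative to its law for the signal \<open>0\<close>,
  which is \<open>model_law n m \<nu>\<close> itself because the observations are then pure noise. The law of the
  measurements \<open>a\<close> does not depend on the signal, so only the shift of the noise contributes.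
\<close>

definition likelihood_ratio ::
  "nat \<Rightarrow> nat \<Rightarrow> real \<Rightarrow> (nat \<Rightarrow> real) \<Rightarrow> (nat \<Rightarrow> nat \<Rightarrow> real) \<times> (nat \<Rightarrow> real) \<Rightarrow> real" where
  "likelihood_ratio n m \<nu> x = (\<lambda>(a, y).
     exp ((\<Sum>i<m. y i * rn_inner n (a i) x - (rn_inner n (a i) x)\<^sup>2 / 2) / \<nu>\<^sup>2))"

lemma prob_space_std_normal_vector: "prob_space (std_normal_vector n)"
  unfolding std_normal_vector_def by (intro prob_space_PiM prob_space_gauss) simp

lemma prob_space_model_law:
  assumes "\<nu> > 0"
  shows "prob_space (model_law n m \<nu>)"
  unfolding model_law_def
  by (intro prob_space_pair prob_space_PiM prob_space_std_normal_vector prob_space_gauss assms)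

lemma sets_std_normal_vector[measurable_cong]: "sets (std_normal_vector n) = sets (rn_borel n)"
  unfolding std_normal_vector_def rn_borel_def by (intro sets_PiM_cong) auto

lemma sets_measurements[measurable_cong]:
  "sets (PiM {..<m} (\<lambda>_. std_normal_vector n)) = sets (PiM {..<m} (\<lambda>_. rn_borel n))"
  by (intro sets_PiM_cong) (auto simp: sets_std_normal_vector)

lemma sets_noise[measurable_cong]: "sets (PiM {..<m} (\<lambda>_. gauss \<nu>)) = sets (rn_borel m)"
  unfolding rn_borel_def by (intro sets_PiM_cong) auto

lemma sets_model_law[measurable_cong]:
  "sets (model_law n m \<nu>) = sets (PiM {..<m} (\<lambda>_. rn_borel n) \<Otimes>\<^sub>M rn_borel m)"
  unfolding model_law_def by (intro sets_pair_measure_cong sets_measurements sets_noise)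

lemma measurable_rn_coordinate[measurable]:
  "j < n \<Longrightarrow> (\<lambda>v. v j) \<in> borel_measurable (rn_borel n)"
  unfolding rn_borel_def by simp

lemma measurable_rn_inner[measurable]: "(\<lambda>v. rn_inner n v x) \<in> borel_measurable (rn_borel n)"
  unfolding rn_inner_def by measurable

lemma measurable_rn_dist[measurable]: "(\<lambda>v. rn_dist n v x) \<in> borel_measurable (rn_borel n)"
  unfolding rn_dist_def rn_norm_def L2_set_def by measurable

lemma measurable_likelihood_ratio[measurable]:
  "likelihood_ratio n m \<nu> x \<in> borel_measurable (PiM {..<m} (\<lambda>_. rn_borel n) \<Otimes>\<^sub>M rn_borel m)"
  unfolding likelihood_ratio_def by measurable

lemma measurable_observations:
  "(\<lambda>(a, e). (a, observations n m x a e)) \<in>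
     (PiM {..<m} (\<lambda>_. rn_borel n) \<Otimes>\<^sub>M rn_borel m) \<rightarrow>\<^sub>M (PiM {..<m} (\<lambda>_. rn_borel n) \<Otimes>\<^sub>M rn_borel m)"
proof -
  have "(\<lambda>(a, e). observations n m x a e) \<in>
     (PiM {..<m} (\<lambda>_. rn_borel n) \<Otimes>\<^sub>M rn_borel m) \<rightarrow>\<^sub>M rn_borel m"
    unfolding observations_def rn_borel_def[of m] case_prod_beta
    by (rule measurable_restrict) (simp add: rn_borel_def[of m, symmetric])
  then show ?thesis by (simp add: case_prod_beta)
qed

text \<open>
  For fixed measurements \<open>a\<close>, passing from the noise to the observations is a shift by the vector
  with entries \<open>\<langle>a\<^sub>i, x\<rangle>\<close>; the shift formula is applied under the integral over \<open>a\<close>.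
\<close>

lemma change_of_measure:
  assumes \<nu>: "\<nu> > 0"
    and h: "h \<in> borel_measurable (PiM {..<m} (\<lambda>_. rn_borel n) \<Otimes>\<^sub>M rn_borel m)"
  shows "(\<integral>\<^sup>+ (a, e). h (a, observations n m x a e) \<partial>model_law n m \<nu>) =
    (\<integral>\<^sup>+ \<omega>. ennreal (likelihood_ratio n m \<nu> x \<omega>) * h \<omega> \<partial>model_law n m \<nu>)"
proof -
  note h[measurable]
  let ?A = "PiM {..<m} (\<lambda>_. std_normal_vector n)" and ?E = "PiM {..<m} (\<lambda>_. gauss \<nu>)"
  interpret E: prob_space ?E by (intro prob_space_PiM prob_space_gauss \<nu>)
  note measurable_observations[measurable]
  have inner: "(\<integral>\<^sup>+ e. h (a, observations n m x a e) \<partial>?E) =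
      (\<integral>\<^sup>+ e. ennreal (likelihood_ratio n m \<nu> x (a, e)) * h (a, e) \<partial>?E)" if a: "a \<in> space ?A" for a
  proof -
    let ?b = "\<lambda>i. rn_inner n (a i) x"
    have h_a: "(\<lambda>y. h (a, y)) \<in> borel_measurable (rn_borel m)"
      using a by (intro measurable_compose[OF measurable_Pair1' h]) (simp add: sets_eq_imp_space_eq[OF sets_measurements])
    have h_a': "(\<lambda>y. h (a, y)) \<in> borel_measurable ?E"
      using h_a by (simp only: measurable_cong_sets[OF sets_noise refl])
    have lr_a: "(\<lambda>e. ennreal (likelihood_ratio n m \<nu> x (a, e))) \<in> borel_measurable ?E"
      unfolding likelihood_ratio_def by simp
    have shift: "(\<lambda>e. \<lambda>i\<in>{..<m}. ?b i + e i) \<in> ?E \<rightarrow>\<^sub>M rn_borel m"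
      unfolding rn_borel_def by (rule measurable_restrict) simp
    have "(\<integral>\<^sup>+ e. h (a, observations n m x a e) \<partial>?E) =
        (\<integral>\<^sup>+ y. h (a, y) \<partial>distr ?E (rn_borel m) (\<lambda>e. \<lambda>i\<in>{..<m}. ?b i + e i))"
      unfolding observations_def by (subst nn_integral_distr[OF shift]) (simp_all only: measurable_distr_eq1 h_a)
    also have "distr ?E (rn_borel m) (\<lambda>e. \<lambda>i\<in>{..<m}. ?b i + e i) =
        density ?E (\<lambda>e. ennreal (likelihood_ratio n m \<nu> x (a, e)))"
      unfolding rn_borel_def likelihood_ratio_def by (subst distr_PiM_gauss_shift[OF \<nu>]) simp_all
    also have "(\<integral>\<^sup>+ y. h (a, y) \<partial>\<dots>) =
        (\<integral>\<^sup>+ e. ennreal (likelihood_ratio n m \<nu> x (a, e)) * h (a, e) \<partial>?E)"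
      by (rule nn_integral_density[OF lr_a h_a'])
    finally show ?thesis .
  qed
  have "(\<integral>\<^sup>+ (a, e). h (a, observations n m x a e) \<partial>model_law n m \<nu>) =
      (\<integral>\<^sup>+ a. \<integral>\<^sup>+ e. h (a, observations n m x a e) \<partial>?E \<partial>?A)"
    unfolding model_law_def
    by (subst E.nn_integral_fst[symmetric]) (simp_all add: case_prod_beta)
  also have "\<dots> = (\<integral>\<^sup>+ a. \<integral>\<^sup>+ e. ennreal (likelihood_ratio n m \<nu> x (a, e)) * h (a, e) \<partial>?E \<partial>?A)"
    by (intro nn_integral_cong inner)
  also have "\<dots> = (\<integral>\<^sup>+ \<omega>. ennreal (likelihood_ratio n m \<nu> x \<omega>) * h \<omega> \<partial>model_law n m \<nu>)"
    unfolding model_law_def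
    by (subst E.nn_integral_fst[symmetric]) simp_all
  finally show ?thesis .
qed

section \<open>The Euclidean norm and distance\<close>

lemma rn_norm_nonneg[simp]: "rn_norm n v \<ge> 0"
  by (simp add: rn_norm_def)

lemma rn_dist_nonneg[simp]: "rn_dist n v w \<ge> 0"
  by (simp add: rn_dist_def)

lemma rn_norm_triangle: "rn_norm n (\<lambda>j. v j + w j) \<le> rn_norm n v + rn_norm n w"
  unfolding rn_norm_def by (rule L2_set_triangle_ineq)

lemma rn_dist_commute: "rn_dist n v w = rn_dist n w v"
  by (simp add: rn_dist_def rn_norm_def L2_set_def power2_commute)

lemma rn_dist_triangle: "rn_dist n v w \<le> rn_dist n u v + rn_dist n u w"
proof -
  have "rn_dist n v w \<le> rn_dist n v u + rn_dist n u w"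
    using rn_norm_triangle[of n "\<lambda>j. v j - u j" "\<lambda>j. u j - w j"] by (simp add: rn_dist_def)
  then show ?thesis by (simp only: rn_dist_commute[of n u v])
qed

lemma rn_dist_le_norms: "rn_dist n v w \<le> rn_norm n v + rn_norm n w"
  using rn_norm_triangle[of n v "\<lambda>j. - w j"]
  by (simp add: rn_dist_def rn_norm_def L2_set_def)

section \<open>Tail of the likelihood ratio\<close>

lemma nn_integral_measurements_square:
  fixes n m :: nat and x :: "nat \<Rightarrow> real"
  shows
  "(\<integral>\<^sup>+ a. ennreal (\<Sum>i<m. (rn_inner n (a i) x)\<^sup>2) \<partial>PiM {..<m} (\<lambda>_. std_normal_vector n)) =
     ennreal (m * (rn_norm n x)\<^sup>2)"
proof -
  have single: "(\<integral>\<^sup>+ v. ennreal ((rn_inner n v x)\<^sup>2) \<partial>std_normal_vector n) = ennreal ((rn_norm n x)\<^sup>2)"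
    using nn_integral_PiM_gauss_linear_square[of 1 "{..<n}" x]
    by (simp add: std_normal_vector_def rn_inner_def rn_norm_def L2_set_def sum_nonneg mult.commute)
  have comp: "(\<integral>\<^sup>+ a. ennreal ((rn_inner n (a i) x)\<^sup>2) \<partial>PiM {..<m} (\<lambda>_. std_normal_vector n)) =
      ennreal ((rn_norm n x)\<^sup>2)" if "i < m" for i
  proof -
    have "(\<integral>\<^sup>+ v. ennreal ((rn_inner n v x)\<^sup>2) \<partial>distr (PiM {..<m} (\<lambda>_. std_normal_vector n)) (std_normal_vector n) (\<lambda>a. a i)) =
      (\<integral>\<^sup>+ a. ennreal ((rn_inner n (a i) x)\<^sup>2) \<partial>PiM {..<m} (\<lambda>_. std_normal_vector n))"
      using that by (subst nn_integral_distr) auto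
    moreover have "distr (PiM {..<m} (\<lambda>_. std_normal_vector n)) (std_normal_vector n) (\<lambda>a. a i) = std_normal_vector n"
      using that by (intro distr_PiM_component prob_space_std_normal_vector) auto
    ultimately show ?thesis using single by simp
  qed
  have "(\<integral>\<^sup>+ a. ennreal (\<Sum>i<m. (rn_inner n (a i) x)\<^sup>2) \<partial>PiM {..<m} (\<lambda>_. std_normal_vector n)) =
     (\<integral>\<^sup>+ a. (\<Sum>i<m. ennreal ((rn_inner n (a i) x)\<^sup>2)) \<partial>PiM {..<m} (\<lambda>_. std_normal_vector n))"
    by simp
  also have "\<dots> = (\<Sum>i<m. \<integral>\<^sup>+ a. ennreal ((rn_inner n (a i) x)\<^sup>2) \<partial>PiM {..<m} (\<lambda>_. std_normal_vector n))"
    by (rule nn_integral_sum) measurable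
  also have "\<dots> = ennreal (m * (rn_norm n x)\<^sup>2)"
    by (simp add: comp ennreal_mult ennreal_of_nat_eq_real_of_nat)
  finally show ?thesis .
qed

text \<open>
  The left side is the probability, under the signal \<open>x\<close>, that the log-likelihood ratio exceeds
  \<open>l\<close>. Put \<open>g\<^sub>i = \<langle>a\<^sub>i, x\<rangle>\<close>. On the observations \<open>y\<^sub>i = g\<^sub>i + \<epsilon>\<^sub>i\<close> this logarithm is
  \<open>(G / 2 + Z) / \<nu>\<^sup>2\<close> with \<open>G = \<Sum>\<^sub>i g\<^sub>i\<^sup>2\<close> and \<open>Z = \<Sum>\<^sub>i g\<^sub>i \<epsilon>\<^sub>i\<close>. If it exceeds \<open>l\<close>, then
  \<open>G \<ge> l \<nu>\<^sup>2\<close> or \<open>Z \<ge> l \<nu>\<^sup>2 / 2\<close>, and Markov's inequality for \<open>G\<close> and for \<open>Z\<^sup>2\<close>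
  gives the two terms of the bound: the expectations of \<open>G\<close> and \<open>Z\<^sup>2\<close> are \<open>m \<parallel>x\<parallel>\<^sup>2\<close> and
  \<open>\<nu>\<^sup>2 m \<parallel>x\<parallel>\<^sup>2\<close>.
\<close>

lemma likelihood_ratio_tail:
  fixes n m :: nat and x :: "nat \<Rightarrow> real" and \<nu> l :: real
  assumes \<nu>: "\<nu> > 0" and l: "l > 0"
  defines "T \<equiv> m * (rn_norm n x)\<^sup>2 / \<nu>\<^sup>2"
  shows "(\<integral>\<^sup>+ \<omega>. ennreal (likelihood_ratio n m \<nu> x \<omega>) *
      indicator {\<omega>. ennreal (likelihood_ratio n m \<nu> x \<omega>) > ennreal (exp l)} \<omega> \<partial>model_law n m \<nu>)
    \<le> ennreal (T / l + 4 * T / l\<^sup>2)"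
proof -
  let ?A = "PiM {..<m} (\<lambda>_. std_normal_vector n)" and ?E = "PiM {..<m} (\<lambda>_. gauss \<nu>)"
  let ?g = "\<lambda>a i. rn_inner n (a i) x"
  let ?G = "\<lambda>a. \<Sum>i<m. (?g a i)\<^sup>2" and ?Z = "\<lambda>a e. \<Sum>i<m. ?g a i * e i"
  interpret E: prob_space ?E by (intro prob_space_PiM prob_space_gauss \<nu>)
  define U where "U = {\<omega> :: (nat \<Rightarrow> nat \<Rightarrow> real) \<times> (nat \<Rightarrow> real).
    ennreal (likelihood_ratio n m \<nu> x \<omega>) > ennreal (exp l)}"
  have "(\<lambda>\<omega>. indicator U \<omega> :: ennreal) = (\<lambda>\<omega>. if ennreal (likelihood_ratio n m \<nu> x \<omega>) > ennreal (exp l) then 1 else 0)"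
    by (auto simp: U_def)
  then have [measurable]: "(\<lambda>\<omega>. indicator U \<omega> :: ennreal) \<in>
      borel_measurable (PiM {..<m} (\<lambda>_. rn_borel n) \<Otimes>\<^sub>M rn_borel m)"
    by simp
  \<comment> \<open>The sum on the right is at least 1 on the event, so its expectation bounds the probability.\<close>
  have pointwise: "indicator U (a, observations n m x a e) \<le>
      ennreal (?G a / (l * \<nu>\<^sup>2)) + ennreal (4 / (l * \<nu>\<^sup>2)\<^sup>2) * ennreal ((?Z a e)\<^sup>2)" for a e
  proof (cases "(a, observations n m x a e) \<in> U")
    case True
    have "(\<Sum>i<m. observations n m x a e i * ?g a i - (?g a i)\<^sup>2 / 2) = ?G a / 2 + ?Z a e"
      by (simp add: observations_def sum_divide_distrib sum.distrib[symmetric] field_simps power2_eq_square)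
    then have "l < (?G a / 2 + ?Z a e) / \<nu>\<^sup>2"
      using True by (simp add: U_def likelihood_ratio_def ennreal_less_iff)
    then have big: "l * \<nu>\<^sup>2 < ?G a / 2 + ?Z a e"
      using \<nu> by (simp add: field_simps)
    have pos: "l * \<nu>\<^sup>2 > 0" using l \<nu> by simp
    have G0: "?G a \<ge> 0" by (intro sum_nonneg) simp
    have "1 \<le> ?G a / (l * \<nu>\<^sup>2) + 4 / (l * \<nu>\<^sup>2)\<^sup>2 * (?Z a e)\<^sup>2"
    proof (cases "?G a \<ge> l * \<nu>\<^sup>2")
      case True
      then show ?thesis using pos by (intro add_increasing2) auto
    next
      case False
      then have "l * \<nu>\<^sup>2 / 2 \<le> ?Z a e" using big by simp
      then have "(l * \<nu>\<^sup>2 / 2)\<^sup>2 \<le> (?Z a e)\<^sup>2" using pos by (intro power_mono) auto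
      then have "(l * \<nu>\<^sup>2)\<^sup>2 \<le> 4 * (?Z a e)\<^sup>2" by (simp add: power_divide)
      then have "1 \<le> 4 / (l * \<nu>\<^sup>2)\<^sup>2 * (?Z a e)\<^sup>2"
        using pos by (simp only: times_divide_eq_left le_divide_eq_1_pos zero_less_power)
      then show ?thesis using G0 pos by (intro add_increasing) auto
    qed
    then show ?thesis
      using True G0 pos by (simp add: ennreal_mult[symmetric] ennreal_plus[symmetric] del: ennreal_plus)
  qed simp
  have "(\<integral>\<^sup>+ \<omega>. ennreal (likelihood_ratio n m \<nu> x \<omega>) * indicator U \<omega> \<partial>model_law n m \<nu>) =
      (\<integral>\<^sup>+ (a, e). indicator U (a, observations n m x a e) \<partial>model_law n m \<nu>)"
    by (rule change_of_measure[OF \<nu>, symmetric]) measurable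
  also have "\<dots> \<le> (\<integral>\<^sup>+ (a, e). ennreal (?G a / (l * \<nu>\<^sup>2)) +
      ennreal (4 / (l * \<nu>\<^sup>2)\<^sup>2) * ennreal ((?Z a e)\<^sup>2) \<partial>model_law n m \<nu>)"
    by (intro nn_integral_mono) (use pointwise in auto)
  also have "\<dots> = (\<integral>\<^sup>+ a. \<integral>\<^sup>+ e. ennreal (?G a / (l * \<nu>\<^sup>2)) +
      ennreal (4 / (l * \<nu>\<^sup>2)\<^sup>2) * ennreal ((?Z a e)\<^sup>2) \<partial>?E \<partial>?A)"
    unfolding model_law_def by (subst E.nn_integral_fst[symmetric]) simp_all
  also have "\<dots> = (\<integral>\<^sup>+ a. ennreal (1 / (l * \<nu>\<^sup>2) + 4 / (l * \<nu>\<^sup>2)\<^sup>2 * \<nu>\<^sup>2) * ennreal (?G a) \<partial>?A)"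
  proof (rule nn_integral_cong)
    fix a assume "a \<in> space ?A"
    have G0: "?G a \<ge> 0" by (intro sum_nonneg) simp
    have "(\<integral>\<^sup>+ e. ennreal (?G a / (l * \<nu>\<^sup>2)) + ennreal (4 / (l * \<nu>\<^sup>2)\<^sup>2) * ennreal ((?Z a e)\<^sup>2) \<partial>?E) =
        ennreal (?G a / (l * \<nu>\<^sup>2)) + ennreal (4 / (l * \<nu>\<^sup>2)\<^sup>2) * ennreal (\<nu>\<^sup>2 * ?G a)"
      using nn_integral_PiM_gauss_linear_square[OF \<nu>, of "{..<m}" "?g a"]
      by (simp add: nn_integral_add nn_integral_cmult E.emeasure_space_1)
    also have "\<dots> = ennreal (1 / (l * \<nu>\<^sup>2) + 4 / (l * \<nu>\<^sup>2)\<^sup>2 * \<nu>\<^sup>2) * ennreal (?G a)"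
      using G0 l by (simp add: ennreal_mult[symmetric] ennreal_plus[symmetric] algebra_simps del: ennreal_plus)
    finally show "(\<integral>\<^sup>+ e. ennreal (?G a / (l * \<nu>\<^sup>2)) + ennreal (4 / (l * \<nu>\<^sup>2)\<^sup>2) * ennreal ((?Z a e)\<^sup>2) \<partial>?E) = \<dots>" .
  qed
  also have "\<dots> = ennreal (1 / (l * \<nu>\<^sup>2) + 4 / (l * \<nu>\<^sup>2)\<^sup>2 * \<nu>\<^sup>2) * ennreal (m * (rn_norm n x)\<^sup>2)"
    by (simp add: nn_integral_cmult nn_integral_measurements_square)
  also have "\<dots> = ennreal (T / l + 4 * T / l\<^sup>2)"
    using l \<nu> by (simp add: ennreal_mult[symmetric] T_def field_simps power2_eq_square)
  finally show ?thesis by (simp add: U_def)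
qed

section \<open>Risk over a separated set\<close>

text \<open>
  Signals at mutual distance \<open>r\<close> cannot be resolved at the scale \<open>r / 2\<close> when their squared
  norms are small compared with \<open>\<nu>\<^sup>2 / m\<close> times the logarithm of their number. The hypothesis test is run at the threshold
  \<open>\<Lambda> = \<surd>N\<close>, with \<open>N = card X\<close>. Then \<open>ln \<Lambda> = ln N / 2\<close>, so the assumed inequality says that the
  tail bound is at most \<open>1 / 8\<close>; and \<open>\<Lambda> / N \<le> 3 / 4\<close> already for \<open>N = 2\<close>, which lets one
  statement cover pairs of points as well as large packings. Since \<open>1 - 1/8 - 3/4 = 1/8\<close>, the risk
  is at least \<open>r / 2 \<cdot> 1 / 8\<close>.
\<close>

lemma packing_risk_lower_bound:
  assumes \<nu>: "\<nu> > 0" and xhat: "xhat \<in> estimators n m"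
    and X: "finite X" "card X \<ge> 2" "X \<subseteq> K"
    and norm: "\<And>x. x \<in> X \<Longrightarrow> rn_norm n x \<le> s"
    and sep: "\<And>x y. x \<in> X \<Longrightarrow> y \<in> X \<Longrightarrow> x \<noteq> y \<Longrightarrow> r \<le> rn_dist n x y"
    and r: "r \<ge> 0"
  defines "T \<equiv> m * s\<^sup>2 / \<nu>\<^sup>2"
  assumes small: "2 * T / ln (card X) + 16 * T / (ln (card X))\<^sup>2 \<le> 1 / 8"
  shows "ennreal (r / 16) \<le> (SUP x\<in>K. risk n m \<nu> xhat x)"
proof (cases "SUP x\<in>K. risk n m \<nu> xhat x")
  case top
  show ?thesis unfolding top by simp
next
  case (real R)
  interpret Q: prob_space "model_law n m \<nu>" by (rule prob_space_model_law[OF \<nu>])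
  have [measurable]: "xhat \<in> (PiM {..<m} (\<lambda>_. rn_borel n) \<Otimes>\<^sub>M rn_borel m) \<rightarrow>\<^sub>M rn_borel n"
    using xhat by (simp add: estimators_def)
  let ?N = "real (card X)"
  let ?L = "\<lambda>x \<omega>. ennreal (likelihood_ratio n m \<nu> x \<omega>)"
  let ?loss = "\<lambda>x \<omega>. ennreal (rn_dist n (xhat \<omega>) x)"
  have N2: "?N \<ge> 2" using X(2) by simp
  define l where "l = ln ?N / 2"
  have l: "l > 0" using N2 by (simp add: l_def)
  have exp_l: "exp l = sqrt ?N"
    using N2 exp_double[of l] by (intro real_sqrt_unique[symmetric]) (simp_all add: l_def)
  have bound: "r / 2 * (1 - 1 / 8 - exp l / ?N) \<le> R"
  proof (rule Q.multiple_hypotheses_lower_bound[where L = ?L and loss = ?loss])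
    fix x assume x: "x \<in> X"
    show "(\<integral>\<^sup>+ \<omega>. ?L x \<omega> \<partial>model_law n m \<nu>) = 1"
      using change_of_measure[OF \<nu>, of "\<lambda>_. 1" m n x] by (simp add: case_prod_beta' Q.emeasure_space_1)
    let ?T = "m * (rn_norm n x)\<^sup>2 / \<nu>\<^sup>2"
    have T: "?T \<le> T"
      unfolding T_def using norm[OF x] by (intro divide_right_mono mult_left_mono power_mono) auto
    have "?T / l + 4 * ?T / l\<^sup>2 \<le> T / l + 4 * T / l\<^sup>2"
      using T l by (intro add_mono divide_right_mono mult_left_mono) auto
    also have "\<dots> \<le> 1 / 8"
      using small by (simp add: l_def power_divide)
    finally have "?T / l + 4 * ?T / l\<^sup>2 \<le> 1 / 8" .
    then show "(\<integral>\<^sup>+ \<omega>. ?L x \<omega> * indicator {\<omega>. ?L x \<omega> > ennreal (exp l)} \<omega> \<partial>model_law n m \<nu>)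
        \<le> ennreal (1 / 8)"
      using likelihood_ratio_tail[OF \<nu> l, of n m x] by (meson ennreal_leI order_trans)
    have "(\<integral>\<^sup>+ \<omega>. ?L x \<omega> * ?loss x \<omega> \<partial>model_law n m \<nu>) = risk n m \<nu> xhat x"
      unfolding risk_def by (rule change_of_measure[OF \<nu>, symmetric]) measurable
    also have "\<dots> \<le> ennreal R"
      using x X real by (metis SUP_upper subsetD)
    finally show "(\<integral>\<^sup>+ \<omega>. ?L x \<omega> * ?loss x \<omega> \<partial>model_law n m \<nu>) \<le> ennreal R" .
    show "ennreal (r / 2) \<le> ?loss y \<omega>"
      if "y \<in> X" "x \<noteq> y" "?loss x \<omega> < ennreal (r / 2)" for y \<omega>
      using sep[OF x that(1,2)] rn_dist_triangle[of n x y "xhat \<omega>"] that(3)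
      by (intro ennreal_leI) (simp add: ennreal_less_iff)
    show "?L x \<in> borel_measurable (model_law n m \<nu>)" by measurable
    show "?loss x \<in> borel_measurable (model_law n m \<nu>)" by measurable
  next
    show "finite X" "X \<noteq> {}" using X by auto
    show "r / 2 \<ge> 0" using r by simp
    show "R \<ge> 0" using real by simp
  qed simp_all
  have exp_le: "exp l / ?N \<le> 3 / 4"
  proof -
    have "sqrt ?N \<le> 3 / 4 * ?N"
    proof (rule real_le_lsqrt)
      have "16 * ?N \<le> 9 * ?N * ?N" using N2 by (intro mult_right_mono) auto
      then show "?N \<le> (3 / 4 * ?N)\<^sup>2" by (simp add: power2_eq_square)
    qed simp_all
    then show ?thesis using N2 by (simp add: exp_l divide_le_eq)
  qed
  have "r / 2 * (1 - 1 / 8 - 3 / 4) \<le> r / 2 * (1 - 1 / 8 - exp l / ?N)"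
    by (intro mult_left_mono diff_left_mono exp_le) (use r in simp)
  also note bound
  finally have "r / 16 \<le> R" by simp
  then show ?thesis unfolding real(2) by (rule ennreal_leI)
qed

section \<open>The lower bound for star-shaped sets\<close>

lemma delta_star_le:
  assumes "\<nu> > 0" and "t > 0"
  shows "delta_star n m \<nu> K \<le>
    t + \<nu> / sqrt m * (1 + sqrt (ln (local_packing_number n K t)))"
  unfolding delta_star_def
proof (rule cINF_lower)
  have ln_nat: "0 \<le> ln (real k)" for k :: nat
    by (cases k) auto
  show "bdd_below ((\<lambda>t. t + \<nu> / sqrt m * (1 + sqrt (ln (local_packing_number n K t)))) ` {0<..})"
    using assms ln_nat by (intro bdd_belowI2[where m = 0]) (auto intro!: add_nonneg_nonneg mult_nonneg_nonneg)
qed (use assms in simp)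

lemma local_packing_attained:
  assumes "K \<subseteq> {..<n} \<rightarrow>\<^sub>E UNIV" and "t > 0"
  obtains X where "is_packing n (K \<inter> {v. rn_norm n v \<le> t}) (t / 10) X"
    and "finite X" and "card X = local_packing_number n K t"
proof -
  let ?P = "{X. is_packing n (K \<inter> {v. rn_norm n v \<le> t}) (t / 10) X}"
  have "{} \<in> ?P" by (simp add: is_packing_def)
  then have "Max (card ` ?P) \<in> card ` ?P"
    using local_packings_finite(2)[OF assms] by (intro Max_in) auto
  then show ?thesis
    using that local_packings_finite(1)[OF assms]
    by (auto simp: local_packing_number_def packing_number_def)
qed

text \<open>
  No optimal radius has to be found: testing the infimum at the single radius
  \<open>t = d / 16\<close> is enough. It gives \<open>d \<le> t + u + u q\<close> with \<open>q = \<surd>(ln P\<^sub>t)\<close>, and since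
  \<open>t\<close> and \<open>u\<close> are small fractions of \<open>d\<close>, the term \<open>u q\<close> is at least \<open>d / 2\<close>. Hence the
  local packing is large (\<open>q \<ge> 2\<close>) and lies in a ball of radius \<open>t \<le> u q / 8\<close>, small enough for the
  bound over separated sets; its separation \<open>t / 10\<close> is a constant multiple of \<open>d\<close>.
\<close>

lemma risk_lower_bound_large_delta:
  fixes K :: "(nat \<Rightarrow> real) set" and n m :: nat
  assumes \<nu>: "\<nu> > 0" and m: "m \<ge> 1" and xhat: "xhat \<in> estimators n m"
    and K: "K \<subseteq> {..<n} \<rightarrow>\<^sub>E UNIV"
  defines "u \<equiv> \<nu> / sqrt m" and "d \<equiv> delta_star n m \<nu> K"
  assumes large: "4 * u \<le> d"
  shows "ennreal (d / 2560) \<le> (SUP x\<in>K. risk n m \<nu> xhat x)"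
proof -
  have u: "u > 0" using \<nu> m by (simp add: u_def)
  define t where "t = d / 16"
  have t: "t > 0" using u large by (simp add: t_def)
  obtain X where X: "is_packing n (K \<inter> {v. rn_norm n v \<le> t}) (t / 10) X"
    and finX: "finite X" and card: "card X = local_packing_number n K t"
    using local_packing_attained[OF K t] .
  define q where "q = sqrt (ln (card X))"
  have "d \<le> t + u * (1 + q)"
    using delta_star_le[OF \<nu> t, of n m K] by (simp add: d_def u_def q_def card)
  then have uq: "d / 2 \<le> u * q"
    using large u t by (simp add: t_def algebra_simps)
  then have "u * 2 \<le> u * q" using large by simp
  then have q2: "q \<ge> 2" using u by simp
  have q_sq: "ln (card X) = q\<^sup>2"
  proof -
    have "ln (card X) \<ge> 0" using q2 by (cases "card X") (auto simp: q_def)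
    then show ?thesis by (simp add: q_def)
  qed
  have "ln (card X) > 0" unfolding q_sq using q2 by simp
  then have card2: "card X \<ge> 2"
    by (cases "card X = 0"; cases "card X = 1") auto
  have "m * t\<^sup>2 / \<nu>\<^sup>2 = (t / u)\<^sup>2"
    using m by (simp add: u_def power_divide power_mult_distrib)
  also have "\<dots> \<le> (q / 8)\<^sup>2"
  proof (rule power_mono)
    show "t / u \<le> q / 8" using uq u by (simp add: t_def field_simps)
  qed (use t u in simp)
  finally have T: "m * t\<^sup>2 / \<nu>\<^sup>2 \<le> q\<^sup>2 / 64" by (simp add: power_divide)
  have "2 * (m * t\<^sup>2 / \<nu>\<^sup>2) / q\<^sup>2 + 16 * (m * t\<^sup>2 / \<nu>\<^sup>2) / (q\<^sup>2)\<^sup>2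
      \<le> 2 * (q\<^sup>2 / 64) / q\<^sup>2 + 16 * (q\<^sup>2 / 64) / (q\<^sup>2)\<^sup>2"
    by (intro add_mono divide_right_mono mult_left_mono T) auto
  also have "\<dots> = 1 / 32 + 1 / (4 * q\<^sup>2)"
    using q2 by (simp add: field_simps)
  also have "\<dots> \<le> 1 / 32 + 1 / (4 * 2\<^sup>2)"
    using q2 by (intro add_left_mono divide_left_mono mult_left_mono power_mono) auto
  also have "\<dots> \<le> 1 / 8" by simp
  finally have small: "2 * (m * t\<^sup>2 / \<nu>\<^sup>2) / ln (card X) + 16 * (m * t\<^sup>2 / \<nu>\<^sup>2) / (ln (card X))\<^sup>2 \<le> 1 / 8"
    by (simp only: q_sq)
  have "ennreal (t / 10 / 16) \<le> (SUP x\<in>K. risk n m \<nu> xhat x)"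
    using X t by (intro packing_risk_lower_bound[OF \<nu> xhat finX card2 _ _ _ _ small])
      (auto simp: is_packing_def)
  then show ?thesis by (simp add: t_def)
qed

lemma rn_norm_scale: "rn_norm n (\<lambda>j\<in>{..<n}. c * v j) = \<bar>c\<bar> * rn_norm n v"
proof -
  have "(\<Sum>i<n. (if i < n then c * v i else undefined)\<^sup>2) = c\<^sup>2 * (\<Sum>i<n. (v i)\<^sup>2)"
    by (simp add: sum_distrib_left power_mult_distrib)
  then show ?thesis
    by (simp add: rn_norm_def L2_set_def real_sqrt_mult)
qed

text \<open>
  The origin and the point of norm \<open>s = min \<parallel>v\<parallel> (u / 18)\<close> on the segment from the origin to \<open>v\<close>
  both lie in the star-shaped set and cannot be told apart reliably. Since
  \<open>ln 2 \<ge> 2 / 3\<close>, the smallness condition for two points follows from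
  \<open>(3 + 36) (s / u)\<^sup>2 \<le> 1 / 8\<close>, which is why 18 is taken as the denominator.
\<close>

lemma risk_lower_bound_two_points:
  fixes K :: "(nat \<Rightarrow> real) set" and n m :: nat
  assumes \<nu>: "\<nu> > 0" and m: "m \<ge> 1" and xhat: "xhat \<in> estimators n m"
    and K: "star_shaped n K" and v: "v \<in> K"
  defines "u \<equiv> \<nu> / sqrt m"
  shows "ennreal (min (rn_norm n v) u / 288) \<le> (SUP x\<in>K. risk n m \<nu> xhat x)"
proof (cases "rn_norm n v = 0")
  case True
  have "u \<ge> 0" using \<nu> by (simp add: u_def)
  with True show ?thesis by simp
next
  case False
  then have v0: "rn_norm n v > 0" by (simp add: less_le)
  have u: "u > 0" using \<nu> m by (simp add: u_def)
  define s where "s = min (rn_norm n v) (u / 18)"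
  have s: "0 < s" "s \<le> rn_norm n v" "s \<le> u / 18" using v0 u by (auto simp: s_def)
  let ?p = "\<lambda>c. \<lambda>j\<in>{..<n}. c * v j"
  let ?c = "s / rn_norm n v"
  have inK: "?p c \<in> K" if "c \<in> {0..1}" for c
  proof -
    have "(\<lambda>v. \<lambda>j\<in>{..<n}. c * v j) ` K \<subseteq> K" using K that unfolding star_shaped_def by blast
    then show ?thesis using v by blast
  qed
  have dist: "rn_dist n (?p a) (?p b) = \<bar>a - b\<bar> * rn_norm n v" for a b
  proof -
    have "rn_dist n (?p a) (?p b) = rn_norm n (?p (a - b))"
      by (simp add: rn_dist_def rn_norm_def left_diff_distrib cong: L2_set_cong_simp)
    then show ?thesis by (simp only: rn_norm_scale)
  qed
  have "?p 0 \<noteq> ?p ?c"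
    using dist[of 0 ?c] dist[of 0 0] s v0 by auto
  then have card: "card {?p 0, ?p ?c} = 2" by simp
  have ln2: "ln 2 \<ge> (2 / 3 :: real)" by (rule ln2_ge_two_thirds)
  have "m * s\<^sup>2 / \<nu>\<^sup>2 = (s / u)\<^sup>2"
    using m by (simp add: u_def power_divide power_mult_distrib)
  also have "\<dots> \<le> (1 / 18)\<^sup>2"
    using s u by (intro power_mono) (auto simp: field_simps)
  finally have T: "m * s\<^sup>2 / \<nu>\<^sup>2 \<le> 1 / 324" by (simp add: power2_eq_square)
  have "2 * (m * s\<^sup>2 / \<nu>\<^sup>2) / ln 2 + 16 * (m * s\<^sup>2 / \<nu>\<^sup>2) / (ln 2)\<^sup>2
      \<le> 2 * (1 / 324) / (2 / 3) + 16 * (1 / 324) / (2 / 3)\<^sup>2"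
    by (intro add_mono frac_le mult_left_mono power_mono T ln2) auto
  also have "\<dots> \<le> 1 / 8" by (simp add: power2_eq_square)
  finally have small: "2 * (m * s\<^sup>2 / \<nu>\<^sup>2) / ln (card {?p 0, ?p ?c}) +
      16 * (m * s\<^sup>2 / \<nu>\<^sup>2) / (ln (card {?p 0, ?p ?c}))\<^sup>2 \<le> 1 / 8"
    unfolding card by simp
  have "ennreal (s / 16) \<le> (SUP x\<in>K. risk n m \<nu> xhat x)"
  proof (rule packing_risk_lower_bound[OF \<nu> xhat _ _ _ _ _ _ small])
    show "{?p 0, ?p ?c} \<subseteq> K" using inK[of 0] inK[of ?c] s v0 by (simp only: insert_subset) simp
    show "rn_norm n x \<le> s" if "x \<in> {?p 0, ?p ?c}" for x
      using that s v0 by (auto simp only: insert_iff empty_iff rn_norm_scale) simp_all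
    show "s \<le> rn_dist n x y" if "x \<in> {?p 0, ?p ?c}" "y \<in> {?p 0, ?p ?c}" "x \<noteq> y" for x y
      using that s v0 by (auto simp only: insert_iff empty_iff dist) simp_all
  qed (use card s in auto)
  moreover have "min (rn_norm n v) u / 288 \<le> s / 16"
    using v0 u by (auto simp: s_def min_def)
  ultimately show ?thesis by (meson ennreal_leI order_trans)
qed

text \<open>
  When \<open>\<delta>\<^sub>*\<close> is at most a multiple of \<open>u = \<nu> / \<surd>m\<close>, two points suffice. If some point of \<open>K\<close> has
  norm at least \<open>u\<close>, the risk is at least of order \<open>u\<close>; otherwise it is at least of the order of
  every norm in \<open>K\<close>, hence of the diameter.
\<close>

lemma risk_lower_bound_small_delta:
  fixes K :: "(nat \<Rightarrow> real) set" and n m :: nat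
  assumes \<nu>: "\<nu> > 0" and m: "m \<ge> 1" and xhat: "xhat \<in> estimators n m"
    and K: "star_shaped n K"
    and small: "delta_star n m \<nu> K \<le> 4 * (\<nu> / sqrt m)"
  shows "ennreal (1 / 1152) * min (ennreal (delta_star n m \<nu> K)) (rn_diam n K)
    \<le> (SUP x\<in>K. risk n m \<nu> xhat x)"
    (is "?c * min ?d ?D \<le> ?R")
proof (cases "\<exists>v\<in>K. \<nu> / sqrt m \<le> rn_norm n v")
  case True
  then obtain v where v: "v \<in> K" "\<nu> / sqrt m \<le> rn_norm n v" by blast
  have "?c * min ?d ?D \<le> ?c * ennreal (4 * (\<nu> / sqrt m))"
    using small by (intro mult_left_mono) (auto simp: min_le_iff_disj intro!: ennreal_leI)
  also have "\<dots> = ennreal (\<nu> / sqrt m / 288)"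
    using \<nu> by (subst ennreal_mult[symmetric]) auto
  also have "\<dots> \<le> ?R"
    using risk_lower_bound_two_points[OF \<nu> m xhat K v(1)] v(2) by (simp add: min_absorb2)
  finally show ?thesis .
next
  case False
  then have norm: "ennreal (rn_norm n v / 288) \<le> ?R" if "v \<in> K" for v
    using risk_lower_bound_two_points[OF \<nu> m xhat K that] that by (auto simp: min_def split: if_splits)
  have pair: "?c * ennreal (rn_dist n v w) \<le> ?R" if "v \<in> K" "w \<in> K" for v w
  proof -
    have "rn_dist n v w \<le> 4 * max (rn_norm n v) (rn_norm n w)"
      using rn_dist_le_norms[of n v w] rn_norm_nonneg[of n v] by linarith
    then have "?c * ennreal (rn_dist n v w) \<le> ennreal (max (rn_norm n v) (rn_norm n w) / 288)"
      by (subst ennreal_mult[symmetric]) (auto intro!: ennreal_leI)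
    also have "\<dots> \<le> ?R" using norm that by (simp add: max_def)
    finally show ?thesis .
  qed
  have "?c * min ?d ?D \<le> ?c * ?D" by (intro mult_left_mono) auto
  also have "\<dots> \<le> ?R"
    unfolding rn_diam_def SUP_mult_left_ennreal using pair by (intro SUP_least) auto
  finally show ?thesis .
qed

theorem theorem4p2:
  shows "\<exists>c::real. c > 0 \<and>
    (\<forall>(n::nat) (m::nat) (\<nu>::real) (K :: (nat \<Rightarrow> real) set).
      m \<ge> 1 \<longrightarrow> \<nu> > 0 \<longrightarrow> K \<noteq> {} \<longrightarrow> rn_closed n K \<longrightarrow> star_shaped n K \<longrightarrow>
      (\<forall>xhat\<in>estimators n m.
        (SUP x\<in>K. risk n m \<nu> xhat x)
          \<ge> ennreal c * min (ennreal (delta_star n m \<nu> K)) (rn_diam n K)))"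
  \<comment> \<open>2560 = 16 * 10 * 16: the packing radius is \<open>\<delta>\<^sub>* / 16\<close>, its separation a tenth of that,
    and the risk a sixteenth of the separation.\<close>
proof (intro exI[of _ "1 / 2560"] conjI allI impI ballI)
  fix n m :: nat and \<nu> :: real and K :: "(nat \<Rightarrow> real) set" and xhat
  assume m: "m \<ge> 1" and \<nu>: "\<nu> > 0" and closed: "rn_closed n K" and star: "star_shaped n K"
    and xhat: "xhat \<in> estimators n m"
  let ?d = "delta_star n m \<nu> K" and ?R = "SUP x\<in>K. risk n m \<nu> xhat x"
  show "ennreal (1 / 2560) * min (ennreal ?d) (rn_diam n K) \<le> ?R"
  proof (cases "4 * (\<nu> / sqrt m) \<le> ?d")
    case True
    moreover have "0 < \<nu> / sqrt m" using \<nu> m by simp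
    ultimately have "0 \<le> ?d" by linarith
    have "ennreal (1 / 2560) * min (ennreal ?d) (rn_diam n K) \<le> ennreal (1 / 2560) * ennreal ?d"
      by (intro mult_left_mono) auto
    also have "\<dots> = ennreal (?d / 2560)"
      using \<open>0 \<le> ?d\<close> by (subst ennreal_mult[symmetric]) auto
    also have "\<dots> \<le> ?R"
      by (rule risk_lower_bound_large_delta[OF \<nu> m xhat rn_closed_subset[OF closed] True])
    finally show ?thesis .
  next
    case False
    have "ennreal (1 / 2560) * min (ennreal ?d) (rn_diam n K)
        \<le> ennreal (1 / 1152) * min (ennreal ?d) (rn_diam n K)"
      by (intro mult_right_mono ennreal_leI) auto
    also have "\<dots> \<le> ?R"
      using False by (intro risk_lower_bound_small_delta[OF \<nu> m xhat star]) simp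
    finally show ?thesis .
  qed
qed simp

end
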